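(* Let $p$ be a prime and $a,c$ positive integers such that $c$ is a primitive divisor of $p^a-1$. Let $b=2^t r_1^{t_1}\cdots r_s^{t_s}$, where $s\ge 1$, $r_1,\ldots,r_s$ are distinct odd primes, $t\ge 0$ and $t_1,\ldots,t_s\ge 1$, and assume $\gcd(p,b)=1$. Put $b'=r_1^{t_1}\cdots r_s^{t_s}$. Assume $\gcd\big(\tfrac{p^a-1}{c},b\big)=1$ and that for each $i=1,\ldots,s$ the multiplicative order of $p^a$ modulo $r_i^{t_i}$ equals $r_i^{h_i}$ for some $0\le h_i\le t_i-1$. If $t\in\{0,1\}$, or if $t\ge 2$ and $p^a\equiv 1\pmod 4$, then $$g\Big(\tfrac{p^{2^tab'}-1}{2^tb'c},\,p^{2^tab'}\Big)=2^t b'\,g\Big(\tfrac{p^a-1}{c},\,p^a\Big).$$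
   Context: For a prime power $q$ and a positive integer $k$, the Waring number $g(k,q)$ is the smallest $s$ (if it exists) such that every element of $\mathbb{F}_q$ is a sum of $s$ $k$-th powers of elements of $\mathbb{F}_q$. An integer $e$ is a primitive divisor of $p^a-1$ if $e\mid p^a-1$ and $e\nmid p^u-1$ for every $1\le u<a$. *)

theory Defs
  imports "HOL-Number_Theory.Number_Theory"
begin

definition primitive_divisor :: "nat \<Rightarrow> nat \<Rightarrow> nat \<Rightarrow> bool" where
  "primitive_divisor p a e \<longleftrightarrow>
     e dvd p ^ a - 1 \<and> (\<forall>u. 1 \<le> u \<and> u < a \<longrightarrow> \<not> e dvd p ^ u - 1)"

definition waring_sum_ok :: "'a::{field,finite} itself \<Rightarrow> nat \<Rightarrow> nat \<Rightarrow> bool" where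
  "waring_sum_ok T k s \<longleftrightarrow>
     (\<forall>x::'a. \<exists>xs::'a list. length xs = s \<and> x = sum_list (map (\<lambda>y. y ^ k) xs))"

text \<open>Waring number g(k,q) of the finite field 'a with q = CARD('a) elements;
  None if it does not exist.\<close>
definition waring_number :: "'a::{field,finite} itself \<Rightarrow> nat \<Rightarrow> nat option" where
  "waring_number T k =
     (if \<exists>s. waring_sum_ok T k s then Some (LEAST s. waring_sum_ok T k s) else None)"

end

theory Submission
  imports Defs "HOL-Computational_Algebra.Polynomial"
begin

text \<open>
  Let \<open>Q = p ^ a\<close> and let \<open>w\<close> generate the subgroup of order \<open>b * c\<close> of the multiplicative group
  of the field \<open>F\<close> with \<open>Q ^ b\<close> elements; it consists of the nonzero powers occurring in the sums.
  Lifting the exponent shows that \<open>b * c\<close> divides \<open>Q ^ d - 1\<close> only if \<open>b\<close> divides \<open>d\<close>, so the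
  conjugates \<open>w ^ Q ^ j\<close> for \<open>j < b\<close> are distinct and \<open>1, w, \<dots>, w ^ (b - 1)\<close> is a basis of \<open>F\<close> over the
  subfield \<open>E\<close> with \<open>Q\<close> elements. Since \<open>w ^ b\<close> generates the group of order \<open>c\<close>, every power in \<open>F\<close>
  is \<open>w ^ i\<close> times a power in \<open>E\<close>. Hence a sum of powers in \<open>F\<close> is a family of \<open>b\<close> unrelated sums of
  powers in \<open>E\<close>, and the Waring number is multiplied by \<open>b\<close>.
\<close>

subsection \<open>Divisibility of geometric sums\<close>

text \<open>Sort the exponents below \<open>m * n\<close> by quotient and remainder modulo
  \<open>m\<close>. This allows a prime factor of the length of the sum to be split off.\<close>

lemma geometric_sum_mult:
  fixes x :: "'a::comm_semiring_1"
  shows "(\<Sum>i<m * n. x ^ i) = (\<Sum>i<m. x ^ i) * (\<Sum>j<n. (x ^ m) ^ j)"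
proof (induction n)
  case (Suc n)
  have "(\<Sum>i<k + m. x ^ i) = (\<Sum>i<k. x ^ i) + x ^ k * (\<Sum>i<m. x ^ i)" for k
    by (induction m) (auto simp: algebra_simps power_add)
  from this[of "m * n"] Suc show ?case
    by (simp add: algebra_simps power_mult)
qed auto

lemma cong_geometric_sum_one:
  fixes x :: int
  assumes "[x = 1] (mod r)"
  shows "[(\<Sum>i<d. x ^ i) = int d] (mod r)"
proof -
  have "[(\<Sum>i<d. x ^ i) = (\<Sum>i<d. 1 ^ i)] (mod r)"
    by (intro cong_sum cong_pow assms)
  thus ?thesis by simp
qed

text \<open>Binomial expansion: all terms beyond the linear one contain
  \<open>r\<^sup>2\<close>.\<close>

lemma power_one_add_cong_square:
  fixes u r :: int
  shows "[(1 + u * r) ^ n = 1 + int n * u * r] (mod r\<^sup>2)"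
proof (induction n)
  case (Suc n)
  have "[(1 + u * r) * (1 + u * r) ^ n = (1 + u * r) * (1 + int n * u * r)] (mod r\<^sup>2)"
    by (intro cong_mult Suc cong_refl)
  also have "(1 + u * r) * (1 + int n * u * r)
      = 1 + int (Suc n) * u * r + r\<^sup>2 * (int n * u\<^sup>2)"
    by (simp add: algebra_simps power2_eq_square)
  also have "[\<dots> = 1 + int (Suc n) * u * r] (mod r\<^sup>2)"
    by (simp add: cong_iff_dvd_diff)
  finally show ?case by simp
qed auto

text \<open>The sum is congruent to \<open>r\<close> modulo \<open>r\<^sup>2\<close>, so it contains
  the prime \<open>r\<close> exactly once. For odd \<open>r\<close>, the linear terms add up to a
  multiple of \<open>r * (0 + ... + (r - 1))\<close>, and the inner sum is itself divisible by
  \<open>r\<close>. For \<open>r = 2\<close> the sum is \<open>1 + x\<close>, which needs the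
  congruence modulo 4.\<close>

lemma geometric_sum_prime_factor:
  fixes x :: int and r :: nat
  assumes "prime r" and x: "[x = 1] (mod int r)" and r2: "odd r \<or> [x = 1] (mod 4)"
  obtains w where "(\<Sum>i<r. x ^ i) = int r * w" and "coprime (int r) w"
proof -
  have r_pos: "r > 0" using \<open>prime r\<close> prime_gt_0_nat by blast
  have "[(\<Sum>i<r. x ^ i) = int r] (mod (int r)\<^sup>2)"
  proof (cases "odd r")
    case True
    from x obtain u where u: "x = 1 + u * int r"
      by (metis cong_iff_lin cong_sym mult.commute)
    have "[(\<Sum>i<r. x ^ i) = (\<Sum>i<r. 1 + int i * u * int r)] (mod (int r)\<^sup>2)"
      unfolding u by (intro cong_sum power_one_add_cong_square)
    also have "(\<Sum>i<r. 1 + int i * u * int r) = int r + u * int r * int (\<Sum>i<r. i)"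
      by (simp add: sum.distrib sum_distrib_left mult_ac)
    also have "(\<Sum>i<r. i) = r * ((r - 1) div 2)"
    proof -
      have "(\<Sum>i<r. i) = r * (r - 1) div 2"
        using gauss_sum_nat[of "r - 1"] r_pos
        by (simp add: lessThan_Suc_atMost[symmetric] atMost_atLeast0[symmetric] mult.commute)
      thus ?thesis using True by (simp add: div_mult_swap)
    qed
    also have "int r + u * int r * int (r * ((r - 1) div 2))
        = int r + (int r)\<^sup>2 * (u * int ((r - 1) div 2))"
      by (simp add: power2_eq_square)
    also have "[\<dots> = int r] (mod (int r)\<^sup>2)"
      by (simp add: cong_iff_dvd_diff)
    finally show ?thesis .
  next
    case False
    with \<open>prime r\<close> have [simp]: "r = 2" using primes_dvd_imp_eq two_is_prime_nat by blast
    from r2 have "[1 + x = 1 + 1] (mod 4)" by (intro cong_add) auto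
    thus ?thesis by (simp add: numeral_2_eq_2 lessThan_Suc add.commute)
  qed
  then obtain v where v: "(\<Sum>i<r. x ^ i) = int r + (int r)\<^sup>2 * v"
    by (metis cong_iff_lin cong_sym)
  show ?thesis
  proof
    show "(\<Sum>i<r. x ^ i) = int r * (1 + int r * v)"
      using v by (simp add: algebra_simps power2_eq_square)
    show "coprime (int r) (1 + int r * v)"
      by (rule coprimeI) (use dvd_add_left_iff dvd_mult2 in blast)
  qed
qed

text \<open>Lifting the exponent: the sum and its length \<open>d\<close> contain the same power of
  \<open>r\<close>. If \<open>r\<close> does not divide \<open>d\<close>, the sum is
  \<open>d\<close> modulo \<open>r\<close>; otherwise one factor \<open>r\<close> is split off from
  both, and the induction hypothesis applies to \<open>d' = d / r\<close>.\<close>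

lemma prime_power_dvd_geometric_sum_iff:
  fixes x :: int and r :: nat
  assumes r: "prime r" and x: "[x = 1] (mod int r)" and r2: "odd r \<or> [x = 1] (mod 4)"
  shows "int (r ^ e) dvd (\<Sum>i<d. x ^ i) \<longleftrightarrow> r ^ e dvd d"
proof (induction d arbitrary: e rule: less_induct)
  case (less d)
  show ?case
  proof (cases e)
    case 0
    thus ?thesis by simp
  next
    case (Suc e')
    show ?thesis
    proof (cases "d > 0 \<and> r dvd d")
      case False
      show ?thesis
      proof (cases "d = 0")
        case d: False
        with False have "\<not> r dvd d" by simp
        moreover have "int r dvd (\<Sum>i<d. x ^ i) \<longleftrightarrow> r dvd d"
          using cong_dvd_iff[OF cong_geometric_sum_one[OF x]] by simp
        moreover have "int r dvd int (r ^ e)" "r dvd r ^ e" using Suc by simp_all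
        ultimately show ?thesis by (meson dvd_trans)
      qed simp
    next
      case True
      then obtain d' where d: "d = d' * r" by (metis dvdE mult.commute)
      have "r > 1" using r prime_gt_1_nat by blast
      have "d' < d" using True \<open>r > 1\<close> d by (cases "d' = 0") auto
      have "[x ^ d' = 1] (mod int r)" "odd r \<or> [x ^ d' = 1] (mod 4)"
        using cong_pow[OF x, of d'] r2 cong_pow[of x 1 4 d'] by auto
      then obtain w where w: "(\<Sum>i<r. (x ^ d') ^ i) = int r * w" "coprime (int r) w"
        using geometric_sum_prime_factor[OF r] by blast
      have "(\<Sum>i<d. x ^ i) = int r * ((\<Sum>i<d'. x ^ i) * w)"
        unfolding d geometric_sum_mult w(1) by simp
      hence "int (r ^ e) dvd (\<Sum>i<d. x ^ i) \<longleftrightarrow> int (r ^ e') dvd (\<Sum>i<d'. x ^ i) * w"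
        using \<open>r > 1\<close> Suc by simp
      also have "\<dots> \<longleftrightarrow> int (r ^ e') dvd (\<Sum>i<d'. x ^ i)"
        using w(2) by (intro coprime_dvd_mult_left_iff) simp
      also have "\<dots> \<longleftrightarrow> r ^ e' dvd d'" by (rule less.IH[OF \<open>d' < d\<close>])
      also have "\<dots> \<longleftrightarrow> r ^ e dvd d" using Suc d \<open>r > 1\<close> by simp
      finally show ?thesis .
    qed
  qed
qed

lemma dvd_iff_prime_powers_dvd:
  fixes b n :: nat
  assumes "b > 0"
  shows "b dvd n \<longleftrightarrow> (\<forall>r e. prime r \<longrightarrow> r ^ e dvd b \<longrightarrow> r ^ e dvd n)"
proof
  assume R: "\<forall>r e. prime r \<longrightarrow> r ^ e dvd b \<longrightarrow> r ^ e dvd n"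
  show "b dvd n"
  proof (cases "n = 0")
    case False
    show ?thesis
    proof (rule multiplicity_le_imp_dvd)
      fix r :: nat assume "prime r"
      with R have "r ^ multiplicity r b dvd n" by (simp add: multiplicity_dvd)
      thus "multiplicity r b \<le> multiplicity r n"
        using False \<open>prime r\<close> by (intro multiplicity_geI) auto
    qed (use assms in auto)
  qed simp
qed (blast intro: dvd_trans)

text \<open>Lifting the exponent is applied to each prime power dividing \<open>b\<close>.\<close>

lemma dvd_geometric_sum_iff:
  fixes b Q :: nat
  assumes "b > 0"
    and r: "\<And>r. prime r \<Longrightarrow> r dvd b \<Longrightarrow> [Q = 1] (mod r)"
    and four: "4 dvd b \<Longrightarrow> [Q = 1] (mod 4)"
  shows "b dvd (\<Sum>i<d. Q ^ i) \<longleftrightarrow> b dvd d"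
proof -
  have "r ^ e dvd (\<Sum>i<d. Q ^ i) \<longleftrightarrow> r ^ e dvd d" if "prime r" "r ^ e dvd b" for r e
  proof (cases "e = 0")
    case False
    hence "r dvd b" using that(2) dvd_power[of e r] dvd_trans by blast
    hence x: "[int Q = 1] (mod int r)" using r[OF that(1)] cong_int_iff[of Q 1 r] by simp
    have "int (r ^ e) dvd (\<Sum>i<d. int Q ^ i) \<longleftrightarrow> r ^ e dvd d"
    proof (cases "odd r \<or> [int Q = 1] (mod 4)")
      case True
      thus ?thesis using prime_power_dvd_geometric_sum_iff[OF that(1) x] by blast
    next
      case False': False
      \<comment> \<open>The only case out of reach of lifting is \<open>r = 2\<close> with
        \<open>Q\<close> not 1 modulo 4. Then 4 does not divide \<open>b\<close>, so only the
        exponent 1 remains, and the congruence modulo 2 suffices.\<close>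
      hence "r = 2" using that(1) primes_dvd_imp_eq two_is_prime_nat by blast
      have "\<not> 4 dvd b" using four False' cong_int_iff[of Q 1 4] by auto
      hence "e < 2"
        using that(2) \<open>r = 2\<close> power_le_dvd[of 2 e b 2] by force
      with \<open>e \<noteq> 0\<close> have "e = 1" by simp
      thus ?thesis using cong_dvd_iff[OF cong_geometric_sum_one[OF x]] by simp
    qed
    moreover have "(\<Sum>i<d. int Q ^ i) = int (\<Sum>i<d. Q ^ i)" by simp
    ultimately show ?thesis using int_dvd_int_iff by metis
  qed simp
  thus ?thesis unfolding dvd_iff_prime_powers_dvd[OF \<open>b > 0\<close>] by blast
qed

lemma power_diff_one_eq_geometric_sum:
  fixes Q :: nat
  assumes "Q \<ge> 1"
  shows "Q ^ d - 1 = (Q - 1) * (\<Sum>i<d. Q ^ i)"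
proof -
  have "Q ^ d = (Q - 1) * (\<Sum>i<d. Q ^ i) + 1"
  proof (induction d)
    case (Suc d)
    have "Q ^ Suc d = (Q - 1) * Q ^ d + Q ^ d"
      using assms by (simp add: algebra_simps diff_mult_distrib)
    with Suc show ?case by (simp add: algebra_simps)
  qed simp
  thus ?thesis by simp
qed

text \<open>In \<open>Q ^ d - 1 = k * c * (\<Sum>i<d. Q ^ i)\<close> the factor \<open>c\<close>
  cancels and \<open>k\<close> is coprime to \<open>b\<close>, so only the geometric sum
  matters.\<close>

lemma mult_dvd_power_diff_one_iff:
  fixes b c Q :: nat
  assumes "b > 0" and "c dvd Q - 1" and "Q > 1" and cop: "coprime ((Q - 1) div c) b"
    and r: "\<And>r. prime r \<Longrightarrow> r dvd b \<Longrightarrow> [Q = 1] (mod r)"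
    and four: "4 dvd b \<Longrightarrow> [Q = 1] (mod 4)"
  shows "b * c dvd Q ^ d - 1 \<longleftrightarrow> b dvd d"
proof -
  define k where "k = (Q - 1) div c"
  have k: "Q - 1 = k * c" "c > 0"
    using assms by (auto simp: k_def intro!: Nat.gr0I)
  have "Q ^ d - 1 = k * (\<Sum>i<d. Q ^ i) * c"
    using power_diff_one_eq_geometric_sum[of Q d] assms(3) k(1) by (simp only: mult_ac)
  hence "b * c dvd Q ^ d - 1 \<longleftrightarrow> b dvd k * (\<Sum>i<d. Q ^ i)"
    using k(2) by simp
  also have "\<dots> \<longleftrightarrow> b dvd (\<Sum>i<d. Q ^ i)"
    using cop unfolding k_def[symmetric]
    by (intro coprime_dvd_mult_right_iff) (simp add: coprime_commute)
  finally show ?thesis using dvd_geometric_sum_iff[OF \<open>b > 0\<close> r four] by simp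
qed

text \<open>By Fermat, raising to the power \<open>r ^ h\<close> changes nothing modulo
  \<open>r\<close>, while the order hypothesis says that the result is 1.\<close>

lemma cong_one_if_ord_prime_power:
  fixes x r :: nat
  assumes "prime r" and "t \<ge> 1" and "ord (r ^ t) x = r ^ h"
  shows "[x = 1] (mod r)"
proof -
  have "[x ^ (r ^ h) = 1] (mod r ^ t)" using ord[of x "r ^ t"] assms(3) by simp
  hence "[x ^ (r ^ h) = 1] (mod r)"
    by (rule cong_dvd_modulus_nat) (use assms(2) in simp)
  moreover have "[x ^ (r ^ h) = x] (mod r)"
  proof (induction h)
    case (Suc h)
    have fermat: "[y ^ r = y] (mod r)" for y
    proof (cases "r dvd y")
      case True
      hence "r dvd y ^ r" using prime_gt_0_nat[OF assms(1)] by (simp add: dvd_power_same dvd_trans[OF True])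
      with True show ?thesis by (simp add: cong_def)
    next
      case False
      from fermat_theorem[OF assms(1) False] have "[y ^ (r - 1) * y = 1 * y] (mod r)"
        by (rule cong_scalar_right)
      thus ?thesis using prime_gt_0_nat[OF assms(1)]
        by (simp only: power_minus_mult mult_1)
    qed
    have "[(x ^ (r ^ h)) ^ r = x ^ (r ^ h)] (mod r)" by (rule fermat)
    also have "[x ^ (r ^ h) = x] (mod r)" by (rule Suc)
    finally show ?case by (simp only: power_Suc2 power_mult)
  qed auto
  ultimately show ?thesis using cong_sym cong_trans by blast
qed

subsection \<open>The multiplicative group of a finite field\<close>

lemma finite_field_generator:
  obtains g :: "'a::{field,finite}"
  where "g \<noteq> 0" and "\<And>x. x \<noteq> 0 \<Longrightarrow> \<exists>i. x = g ^ i"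
    and "\<And>i. g ^ i = 1 \<longleftrightarrow> card (UNIV :: 'a set) - 1 dvd i"
proof -
  \<comment> \<open>The type is packaged as a ring with explicit carrier, so that the cyclicity of
    the multiplicative group of a finite field can be quoted.\<close>
  define R :: "'a ring" where "R = \<lparr>carrier = (UNIV :: 'a set), monoid.mult = (*), one = 1, ring.zero = 0, add = (+)\<rparr>"
  have neg: "\<exists>y. x + y = 0" for x :: 'a
    by (rule exI[of _ "- x"]) simp
  have inv: "\<exists>y. x * y = 1" if "x \<noteq> 0" for x :: 'a
    using that by (intro exI[of _ "inverse x"]) simp
  interpret R: field R
    unfolding R_def by unfold_locales (use neg inv in \<open>auto simp: Units_def algebra_simps\<close>)
  have carr: "carrier R = UNIV" and zero: "\<zero>\<^bsub>R\<^esub> = 0" and one: "\<one>\<^bsub>R\<^esub> = 1"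
    and mul: "x \<otimes>\<^bsub>R\<^esub> y = x * y" for x y
    by (simp_all add: R_def)
  have pow: "x [^]\<^bsub>R\<^esub> n = x ^ n" for x and n :: nat
    by (induction n) (simp_all add: one mul)
  have "\<exists>g\<in>UNIV - {0 :: 'a}. UNIV - {0} = {g ^ i | i::nat. i \<in> UNIV}"
    using R.finite_field_mult_group_has_gen[unfolded carrier_mult_of carr zero pow] by simp
  then obtain g :: 'a where g: "g \<noteq> 0" and gen: "UNIV - {0} = {g ^ i | i::nat. i \<in> UNIV}"
    by blast
  interpret G: group "mult_of R" by (rule R.field_mult_group)
  define N where "N = card (UNIV :: 'a set) - 1"
  have N: "card (UNIV - {0 :: 'a}) = N" by (simp add: N_def card_Diff_singleton)
  have "1 \<in> UNIV - {0 :: 'a}" by simp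
  hence "N > 0" unfolding N[symmetric] by (metis card_gt_0_iff empty_iff finite)
  have "g [^]\<^bsub>mult_of R\<^esub> Coset.order (mult_of R) = \<one>\<^bsub>mult_of R\<^esub>"
    by (rule G.pow_order_eq_1) (simp add: carr zero g)
  hence gN: "g ^ N = 1"
    by (simp add: nat_pow_mult_of pow one Coset.order_def carr zero N)
  have "g ^ i = 1 \<longleftrightarrow> N dvd i" for i
  proof
    assume "N dvd i"
    thus "g ^ i = 1" using gN by (auto simp: power_mult)
  next
    assume gi: "g ^ i = 1"
    define j where "j = i mod N"
    have "g ^ i = g ^ (N * (i div N) + j)" by (simp add: j_def)
    hence gj: "g ^ j = 1" using gi gN by (simp add: power_add power_mult)
    have "j = 0"
    proof (rule ccontr)
      assume "j \<noteq> 0"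
      \<comment> \<open>If \<open>g ^ j = 1\<close> with \<open>0 < j < N\<close>, the powers of
        \<open>g\<close> would take at most \<open>j\<close> values, too few for the
        \<open>N\<close> nonzero elements.\<close>
      have "UNIV - {0} \<subseteq> (\<lambda>l. g ^ l) ` {..<j}"
      proof
        fix x assume "x \<in> UNIV - {0 :: 'a}"
        then obtain l where "x = g ^ l" unfolding gen by auto
        also have "\<dots> = g ^ (j * (l div j) + l mod j)" by simp
        also have "\<dots> = g ^ (l mod j)" using gj by (simp only: power_add power_mult) simp
        finally show "x \<in> (\<lambda>l. g ^ l) ` {..<j}" using \<open>j \<noteq> 0\<close> by auto
      qed
      from card_mono[OF _ this] have "N \<le> card ((\<lambda>l. g ^ l) ` {..<j})" using N by simp
      also have "\<dots> \<le> j" using card_image_le[of "{..<j}"] by simp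
      finally show False using mod_less_divisor[OF \<open>N > 0\<close>, of i] by (simp add: j_def)
    qed
    thus "N dvd i" by (auto simp: j_def)
  qed
  with g gen show ?thesis by (intro that[of g]) (auto simp: N_def)
qed

lemma finite_field_card_gt_1: "card (UNIV :: 'a::{field,finite} set) > 1"
proof -
  have "card {0, 1 :: 'a} \<le> card (UNIV :: 'a set)" by (intro card_mono) auto
  thus ?thesis by simp
qed

lemma finite_field_power_card:
  fixes x :: "'a::{field,finite}"
  shows "x ^ card (UNIV :: 'a set) = x"
proof (cases "x = 0")
  case False
  obtain g :: 'a where g: "\<And>x. x \<noteq> 0 \<Longrightarrow> \<exists>i. x = g ^ i"
    and one: "\<And>i. g ^ i = 1 \<longleftrightarrow> card (UNIV :: 'a set) - 1 dvd i"
    by (rule finite_field_generator) (rule that, blast+)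
  obtain i where i: "x = g ^ i" using g False by blast
  have "x ^ (card (UNIV :: 'a set) - 1) = 1"
    unfolding i power_mult[symmetric] one by simp
  hence "x ^ (card (UNIV :: 'a set) - 1) * x = x" by simp
  thus ?thesis using finite_field_card_gt_1[where 'a = 'a] by (simp only: power_minus_mult)
qed (use finite_field_card_gt_1[where 'a = 'a] in auto)

text \<open>With a generator \<open>g\<close>, the witness is \<open>w = g ^ k\<close>. The second
  part identifies the nonzero \<open>k\<close>-th powers with the \<open>m\<close>-th roots of
  unity, which turns Waring sums into sums over a cyclic group.\<close>

lemma finite_field_power_subgroup:
  assumes km: "card (UNIV :: 'a::{field,finite} set) - 1 = k * m"
  shows "\<exists>w :: 'a. (\<forall>j. w ^ j = 1 \<longleftrightarrow> m dvd j) \<and> (\<forall>x. x ^ m = 1 \<longleftrightarrow> (\<exists>j. x = w ^ j))"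
    and "(x :: 'a) ^ m = 1 \<longleftrightarrow> (\<exists>y. y \<noteq> 0 \<and> x = y ^ k)"
proof -
  obtain g :: 'a where "g \<noteq> 0" and g: "\<And>x. x \<noteq> 0 \<Longrightarrow> \<exists>i. x = g ^ i"
    and one: "\<And>i. g ^ i = 1 \<longleftrightarrow> k * m dvd i"
    by (rule finite_field_generator[where 'a = 'a, unfolded km]) (rule that, blast+)
  have pos: "k > 0" "m > 0"
    using km finite_field_card_gt_1[where 'a = 'a] by (auto intro!: Nat.gr0I)
  have ord: "(g ^ k) ^ j = 1 \<longleftrightarrow> m dvd j" for j
    unfolding power_mult[symmetric] one using pos by simp
  have sub: "\<exists>j. x = (g ^ k) ^ j" if x: "x ^ m = 1" for x :: 'a
  proof -
    have "x \<noteq> 0" using x pos by (auto simp: power_0_left)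
    then obtain i where i: "x = g ^ i" using g by blast
    have "k * m dvd i * m" using x unfolding i power_mult[symmetric] one .
    then obtain j where "i = k * j" using pos by auto
    hence "x = (g ^ k) ^ j" by (simp add: i power_mult)
    thus ?thesis by blast
  qed
  have comm: "(g ^ k) ^ j = (g ^ j) ^ k" for j
    by (simp only: power_mult[symmetric] mult.commute)
  have pow: "(y ^ k) ^ m = 1" if y: "y \<noteq> 0" for y :: 'a
  proof -
    obtain i where i: "y = g ^ i" using g y by blast
    show ?thesis unfolding i power_mult[symmetric] one by (simp add: mult.assoc)
  qed
  have "x ^ m = 1 \<longleftrightarrow> (\<exists>j. x = (g ^ k) ^ j)" for x :: 'a
    using sub pow[of "g ^ _"] \<open>g \<noteq> 0\<close> by (metis comm power_not_zero)
  with ord show "\<exists>w :: 'a. (\<forall>j. w ^ j = 1 \<longleftrightarrow> m dvd j) \<and> (\<forall>x. x ^ m = 1 \<longleftrightarrow> (\<exists>j. x = w ^ j))"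
    by blast
  show "x ^ m = 1 \<longleftrightarrow> (\<exists>y. y \<noteq> 0 \<and> x = y ^ k)"
  proof
    assume "x ^ m = 1"
    then obtain j where "x = (g ^ k) ^ j" using sub by blast
    hence "x = (g ^ j) ^ k" by (simp only: comm)
    thus "\<exists>y. y \<noteq> 0 \<and> x = y ^ k" using \<open>g \<noteq> 0\<close> by (intro exI[of _ "g ^ j"]) simp
  qed (use pow in blast)
qed

lemma card_roots_of_unity_finite_field:
  assumes "m dvd card (UNIV :: 'a::{field,finite} set) - 1"
  shows "card {x :: 'a. x ^ m = 1} = m"
proof -
  from assms obtain k where k: "card (UNIV :: 'a set) - 1 = k * m" by (metis dvdE mult.commute)
  then obtain w :: 'a where ord: "\<And>j. w ^ j = 1 \<longleftrightarrow> m dvd j"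
    and gen: "\<And>x. x ^ m = 1 \<longleftrightarrow> (\<exists>j. x = w ^ j)"
    using finite_field_power_subgroup(1) by blast
  have "m > 0" using k finite_field_card_gt_1[where 'a = 'a] by (auto intro!: Nat.gr0I)
  have "w ^ m = 1" by (simp add: ord)
  hence "w \<noteq> 0" using \<open>m > 0\<close> by (auto simp: power_0_left)
  have inj: "inj_on (\<lambda>j. w ^ j) {..<m}"
  proof (rule linorder_inj_onI)
    fix i j assume ij: "i < j" "i \<in> {..<m}" "j \<in> {..<m}"
    show "w ^ i \<noteq> w ^ j"
    proof
      assume "w ^ i = w ^ j"
      also have "\<dots> = w ^ i * w ^ (j - i)" using ij by (simp flip: power_add)
      finally have "w ^ (j - i) = 1" using \<open>w \<noteq> 0\<close> by simp
      hence "m dvd j - i" by (simp only: ord)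
      from dvd_imp_le[OF this] ij show False by auto
    qed
  qed auto
  have "\<exists>l<m. w ^ j = w ^ l" for j
  proof (intro exI conjI)
    have "w ^ j = w ^ (m * (j div m) + j mod m)" by simp
    thus "w ^ j = w ^ (j mod m)" using \<open>w ^ m = 1\<close> by (simp only: power_add power_mult) simp
  qed (use \<open>m > 0\<close> in simp)
  hence "{x. x ^ m = 1} = (\<lambda>j. w ^ j) ` {..<m}" unfolding gen by auto
  thus ?thesis using card_image[OF inj] by simp
qed

subsection \<open>Embedding finite fields\<close>

text \<open>An integer polynomial can be evaluated in any commutative ring, so one polynomial can be
  compared at points of two different fields.\<close>

definition eval_int_poly :: "int poly \<Rightarrow> 'a::comm_ring_1 \<Rightarrow> 'a" where
  "eval_int_poly f x = poly (map_poly of_int f) x"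

lemma map_poly_of_int_hom:
  "map_poly of_int (f + g) = (map_poly of_int f + map_poly of_int g :: 'a::comm_ring_1 poly)"
  "map_poly of_int (f - g) = (map_poly of_int f - map_poly of_int g :: 'a poly)"
  "map_poly of_int (f * g) = (map_poly of_int f * map_poly of_int g :: 'a poly)"
  by (rule poly_eqI, simp add: coeff_map_poly coeff_mult)+

lemma eval_int_poly_hom:
  "eval_int_poly (f + g) x = eval_int_poly f x + eval_int_poly g x"
  "eval_int_poly (f - g) x = eval_int_poly f x - eval_int_poly g x"
  "eval_int_poly (f * g) x = eval_int_poly f x * eval_int_poly g x"
  "eval_int_poly (smult c f) x = of_int c * eval_int_poly f x"
  "eval_int_poly (monom c n) x = of_int c * x ^ n"
  "eval_int_poly 0 x = 0"
  "eval_int_poly 1 x = 1"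
  by (simp_all add: eval_int_poly_def map_poly_of_int_hom map_poly_smult map_poly_monom poly_monom)

lemma map_poly_of_int_eq_0:
  assumes "of_nat p = (0 :: 'a::comm_ring_1)" and "\<And>i. int p dvd coeff f i"
  shows "map_poly of_int f = (0 :: 'a poly)"
proof (rule poly_eqI)
  fix i
  obtain c where "coeff f i = int p * c" using assms(2)[of i] by (elim dvdE)
  thus "coeff (map_poly of_int f) i = coeff (0 :: 'a poly) i"
    using assms(1) by (simp add: coeff_map_poly)
qed

text \<open>Integer polynomials stand in for polynomials over the prime field, which need not be a type
  here: \<open>n\<close> plays the role of the degree of the minimal polynomial of \<open>\<gamma>\<close>.\<close>
lemma coeff_dvd_if_degree_less_monic:
  fixes \<gamma> :: "'a::comm_ring_1"
  assumes p: "prime p" and p0: "of_nat p = (0 :: 'a)"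
    and min: "\<And>f :: int poly. lead_coeff f = 1 \<Longrightarrow> eval_int_poly f \<gamma> = 0 \<Longrightarrow> n \<le> degree f"
    and "eval_int_poly r \<gamma> = 0" and "r = 0 \<or> degree r < n"
  shows "int p dvd coeff r i"
proof -
  have "\<forall>i. int p dvd coeff r i" if "N \<le> n" "eval_int_poly r \<gamma> = 0" "\<And>i. i \<ge> N \<Longrightarrow> coeff r i = 0" for N r
    using that
  proof (induction N arbitrary: r)
    case (Suc N)
    have p0': "of_int (int p) = (0 :: 'a)" using p0 by simp
    show ?case
    proof (cases "int p dvd coeff r N")
      case True
      then obtain c where c: "coeff r N = int p * c" by (elim dvdE)
      \<comment> \<open>Since \<open>p = 0\<close> in the ring, dropping a term whose coefficient is
        divisible by \<open>p\<close> keeps \<gamma> a root.\<close>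
      define r' where "r' = r - monom (coeff r N) N"
      have "\<forall>i. int p dvd coeff r' i"
      proof (rule Suc.IH)
        show "eval_int_poly r' \<gamma> = 0"
          using Suc.prems(2) p0' by (simp add: r'_def eval_int_poly_hom c)
        show "coeff r' i = 0" if "i \<ge> N" for i
          using Suc.prems(3)[of i] that by (cases "i = N") (auto simp: r'_def)
      qed (use Suc.prems in simp)
      hence "int p dvd coeff r i" if "i \<noteq> N" for i
        using that by (auto simp: r'_def split: if_splits dest: spec[of _ i])
      with True show ?thesis by metis
    next
      case False
      hence "coprime (coeff r N) (int p)"
        using p prime_imp_coprime[of "int p" "coeff r N"] by (simp add: coprime_commute)
      then obtain v where "[coeff r N * v = 1] (mod int p)"
        using cong_solve_coprime_int by blast
      then obtain u where u: "v * coeff r N = 1 + int p * u"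
        by (metis cong_iff_lin cong_sym mult.commute)
      \<comment> \<open>Inverting the top coefficient modulo \<open>p\<close> and correcting by a
        multiple of \<open>p\<close> yields a monic polynomial of degree \<open>N < n\<close> that
        vanishes at \<gamma>, against minimality.\<close>
      define f where "f = smult v r - monom (int p * u) N"
      have coeff_f: "coeff f N = 1" "\<And>i. i > N \<Longrightarrow> coeff f i = 0"
        using Suc.prems(3) by (auto simp: f_def u)
      hence "degree f = N" by (intro antisym degree_le le_degree) auto
      moreover have "eval_int_poly f \<gamma> = 0"
        using Suc.prems(2) p0' by (simp add: f_def eval_int_poly_hom)
      ultimately show ?thesis using min[of f] coeff_f(1) Suc.prems(1) by simp
    qed
  qed (auto intro: poly_eqI)
  from this[of n r] assms(4,5) show ?thesis by (auto simp: coeff_eq_0)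
qed

text \<open>A generator \<gamma> of the first field is sent to a root \<delta> in \<open>'b\<close>
  of a monic integer polynomial \<open>m\<close> of least degree vanishing at \<gamma>; the map
  takes \<open>f(\<gamma>)\<close> to \<open>f(\<delta>)\<close>.\<close>

lemma finite_field_embedding:
  fixes p :: nat
  assumes p: "prime p" and pa: "of_nat p = (0 :: 'a::{field,finite})"
    and pb: "of_nat p = (0 :: 'b::{field,finite})"
    and dvd: "card (UNIV :: 'a set) - 1 dvd card (UNIV :: 'b set) - 1"
  obtains \<phi> :: "'a::{field,finite} \<Rightarrow> 'b::{field,finite}" where "\<And>x y. \<phi> (x + y) = \<phi> x + \<phi> y"
    and "\<And>x y. \<phi> (x * y) = \<phi> x * \<phi> y" and "\<phi> 1 = 1"
proof -
  define q where "q = card (UNIV :: 'a set)"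
  have "q > 1" using finite_field_card_gt_1[where 'a = 'a] by (simp add: q_def)
  obtain \<gamma> :: 'a where gen: "\<And>x. x \<noteq> 0 \<Longrightarrow> \<exists>i. x = \<gamma> ^ i"
    using finite_field_generator by metis
  define P where "P = (\<lambda>f :: int poly. lead_coeff f = 1 \<and> eval_int_poly f \<gamma> = 0)"
  \<comment> \<open>\<open>X\<close> shows that some monic polynomial vanishes at \<gamma>; it also
    has \<open>q\<close> roots in \<open>'b\<close>, which is what produces \<delta>.\<close>
  define X where "X = (monom 1 q - monom 1 1 :: int poly)"
  have X: "eval_int_poly X x = x ^ q - x" for x :: "'c::comm_ring_1"
    by (simp add: X_def eval_int_poly_hom)
  have coeff_X: "coeff X q = 1" "\<And>i. i > q \<Longrightarrow> coeff X i = 0"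
    using \<open>q > 1\<close> by (auto simp: X_def)
  hence "degree X = q" by (intro antisym degree_le le_degree) auto
  hence "P X" using coeff_X finite_field_power_card[of \<gamma>] X[of \<gamma>] by (simp add: P_def q_def)
  then obtain m where m: "P m" and min: "\<And>f. P f \<Longrightarrow> degree m \<le> degree f"
    using ex_has_least_nat[of P X degree] by blast
  have lead: "lead_coeff m = 1" "m \<noteq> 0" using m by (auto simp: P_def)
  have "degree m > 0"
  proof (rule Nat.gr0I)
    assume "degree m = 0"
    hence "m = 1" using lead(1) by (metis degree_eq_zeroE lead_coeff_pCons(2) pCons_one)
    thus False using m by (simp add: P_def eval_int_poly_hom)
  qed
  have div: "\<exists>g. map_poly of_int f = (map_poly of_int m * g :: 'b poly)"
    if f: "eval_int_poly f \<gamma> = 0" for f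
  proof -
    \<comment> \<open>Division by the monic \<open>m\<close> is exact up to a remainder whose
      coefficients are all divisible by \<open>p\<close>, and these vanish in
      \<open>'b\<close>.\<close>
    obtain g r where gr: "pseudo_divmod f m = (g, r)" by fastforce
    from pseudo_divmod[OF lead(2) gr] lead(1) have fgr: "f = m * g + r"
      and r: "r = 0 \<or> degree r < degree m" by simp_all
    have "eval_int_poly r \<gamma> = 0"
      using f m by (simp add: fgr P_def eval_int_poly_hom)
    hence "int p dvd coeff r i" for i
      using coeff_dvd_if_degree_less_monic[OF p pa _ _ r] min by (auto simp: P_def)
    hence "map_poly of_int r = (0 :: 'b poly)" by (rule map_poly_of_int_eq_0[OF pb])
    thus ?thesis by (auto simp: fgr map_poly_of_int_hom)
  qed
  obtain \<delta> :: 'b where \<delta>: "eval_int_poly m \<delta> = 0"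
  proof -
    obtain g where g: "map_poly of_int X = (map_poly of_int m * g :: 'b poly)"
      using div[of X] \<open>P X\<close> by (auto simp: P_def)
    have "coeff (map_poly of_int X :: 'b poly) q = 1" by (simp add: coeff_map_poly coeff_X)
    hence X0: "map_poly of_int X \<noteq> (0 :: 'b poly)" by (metis coeff_0 zero_neq_one)
    have deg_X: "degree (map_poly of_int X :: 'b poly) \<le> q"
      using coeff_X(2) by (auto intro!: degree_le simp: coeff_map_poly)
    have "coeff (map_poly of_int m :: 'b poly) (degree m) = 1"
      by (simp add: coeff_map_poly lead(1))
    hence "degree m \<le> degree (map_poly of_int m :: 'b poly)" by (intro le_degree) simp
    hence "degree g < q" and "g \<noteq> 0"
      using deg_X X0 \<open>degree m > 0\<close> unfolding g by (auto simp: degree_mult_eq)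
    \<comment> \<open>\<open>A\<close> consists of \<open>q\<close> roots of \<open>X\<close> in
      \<open>'b\<close>. The cofactor \<open>g\<close> has degree below \<open>q\<close>, so it
      cannot vanish on all of \<open>A\<close>, and \<open>m\<close> must have a root there.\<close>
    define A where "A = insert 0 {x :: 'b. x ^ (q - 1) = 1}"
    have "card A = q"
      using card_roots_of_unity_finite_field[OF dvd] \<open>q > 1\<close>
      by (simp add: A_def q_def power_0_left)
    have A: "x ^ q = x" if "x \<in> A" for x
      using that \<open>q > 1\<close> power_minus_mult[of q x] by (auto simp: A_def)
    have "\<exists>x\<in>A. eval_int_poly m x = 0"
    proof (rule ccontr)
      assume no_root: "\<not> ?thesis"
      have "A \<subseteq> {x. poly g x = 0}"
      proof
        fix x assume "x \<in> A"
        hence "eval_int_poly X x = 0" using A X[of x] by simp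
        hence "eval_int_poly m x * poly g x = 0"
          by (simp add: eval_int_poly_def g)
        thus "x \<in> {x. poly g x = 0}" using no_root \<open>x \<in> A\<close> by simp
      qed
      hence "q \<le> card {x. poly g x = 0}"
        using card_mono[of "{x. poly g x = 0}" A] \<open>card A = q\<close> by simp
      thus False using card_poly_roots_bound[OF \<open>g \<noteq> 0\<close>] \<open>degree g < q\<close> by simp
    qed
    thus ?thesis using that by blast
  qed
  have vanish: "eval_int_poly f \<delta> = 0" if "eval_int_poly f \<gamma> = 0" for f
    using div[OF that] \<delta> by (auto simp: eval_int_poly_def)
  \<comment> \<open>The choice of \<open>f\<close> is harmless: two candidates differ by a
    polynomial vanishing at \<gamma>, hence at \<delta> by \<open>vanish\<close>.\<close>
  define \<phi> where "\<phi> = (\<lambda>x. eval_int_poly (SOME f. eval_int_poly f \<gamma> = x) \<delta>)"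
  have \<phi>: "\<phi> (eval_int_poly f \<gamma>) = eval_int_poly f \<delta>" for f
  proof -
    define h where "h = (SOME h. eval_int_poly h \<gamma> = eval_int_poly f \<gamma>)"
    have "eval_int_poly h \<gamma> = eval_int_poly f \<gamma>" unfolding h_def by (rule someI[of _ f]) simp
    hence "eval_int_poly (h - f) \<delta> = 0" by (intro vanish) (simp add: eval_int_poly_hom)
    thus ?thesis by (simp add: \<phi>_def h_def[symmetric] eval_int_poly_hom)
  qed
  have surj: "\<exists>f. x = eval_int_poly f \<gamma>" for x
  proof (cases "x = 0")
    case False
    then obtain i where "x = \<gamma> ^ i" using gen by blast
    thus ?thesis by (intro exI[of _ "monom 1 i"]) (simp add: eval_int_poly_hom)
  qed (intro exI[of _ 0], simp add: eval_int_poly_hom)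
  show ?thesis
  proof
    fix x y
    obtain f g where "x = eval_int_poly f \<gamma>" "y = eval_int_poly g \<gamma>" using surj by metis
    thus "\<phi> (x + y) = \<phi> x + \<phi> y" "\<phi> (x * y) = \<phi> x * \<phi> y"
      using \<phi>[of f] \<phi>[of g] \<phi>[of "f + g"] \<phi>[of "f * g"] by (simp_all add: eval_int_poly_hom)
  next
    show "\<phi> 1 = 1" using \<phi>[of 1] by (simp add: eval_int_poly_hom)
  qed
qed

subsection \<open>Waring numbers under field extension\<close>

lemma waring_sum_ok_mono:
  assumes "waring_sum_ok T k s" and "s \<le> s'" and "k > 0"
  shows "waring_sum_ok T k s'"
  unfolding waring_sum_ok_def
proof
  fix x :: 'a
  obtain xs where "length xs = s" "x = sum_list (map (\<lambda>y. y ^ k) xs)"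
    using assms(1) unfolding waring_sum_ok_def by blast
  thus "\<exists>xs. length xs = s' \<and> x = sum_list (map (\<lambda>y. y ^ k) xs)"
    using assms(2,3)
    by (intro exI[of _ "xs @ replicate (s' - s) 0"]) (simp add: sum_list_replicate power_0_left)
qed

lemma sum_list_eq_sum_filter:
  fixes h :: "'b \<Rightarrow> 'c::comm_monoid_add" and f :: "'b \<Rightarrow> nat"
  assumes "\<And>y. f y < n"
  shows "(\<Sum>y\<leftarrow>ys. h y) = (\<Sum>i<n. \<Sum>y\<leftarrow>filter (\<lambda>y. f y = i) ys. h y)"
proof (induction ys)
  case (Cons y ys)
  have "(\<Sum>i<n. \<Sum>y\<leftarrow>filter (\<lambda>y. f y = i) (y # ys). h y)
      = (\<Sum>i<n. (if f y = i then h y else 0) + (\<Sum>y\<leftarrow>filter (\<lambda>y. f y = i) ys. h y))"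
    by (intro sum.cong) auto
  also have "\<dots> = h y + (\<Sum>i<n. \<Sum>y\<leftarrow>filter (\<lambda>y. f y = i) ys. h y)"
    using assms[of y] by (simp add: sum.distrib)
  finally show ?case using Cons by simp
qed simp

lemma additive_zero:
  fixes \<phi> :: "'a::ab_group_add \<Rightarrow> 'b::ab_group_add"
  assumes "\<And>x y. \<phi> (x + y) = \<phi> x + \<phi> y"
  shows "\<phi> 0 = 0"
  using assms[of 0 0] by simp

text \<open>Each \<open>K\<close>-th power involves a single basis element, so a sum of powers splits into \<open>b\<close>
  independent sums over the smaller field; applied to the vector all of whose coordinates are
  equal to a worst element, this forces the cost to be \<open>b\<close> times the cost of that element.\<close>
lemma waring_sum_ok_extension_iff:
  fixes \<phi> :: "'e::{field,finite} \<Rightarrow> 'f::{field,finite}" and w :: 'f and b K k :: nat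
  assumes "b > 0" and "K > 0" and "k > 0"
    and add: "\<And>x y. \<phi> (x + y) = \<phi> x + \<phi> y"
    and span: "\<And>x. \<exists>v. x = (\<Sum>i<b. w ^ i * \<phi> (v i))"
    and indep: "\<And>u v i. (\<Sum>i<b. w ^ i * \<phi> (u i)) = (\<Sum>i<b. w ^ i * \<phi> (v i)) \<Longrightarrow> i < b \<Longrightarrow> u i = v i"
    and pow: "\<And>y. \<exists>i<b. \<exists>u. y ^ K = w ^ i * \<phi> (u ^ k)"
    and pow': "\<And>i u. i < b \<Longrightarrow> \<exists>y. w ^ i * \<phi> (u ^ k) = y ^ K"
  shows "waring_sum_ok TYPE('f) K n \<longleftrightarrow> waring_sum_ok TYPE('e) k (n div b)"
proof
  assume W: "waring_sum_ok TYPE('f) K n"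
  show "waring_sum_ok TYPE('e) k (n div b)"
  proof (rule ccontr)
    assume "\<not> ?thesis"
    then obtain x :: 'e where x: "\<And>xs. length xs = n div b \<Longrightarrow> x \<noteq> (\<Sum>y\<leftarrow>xs. y ^ k)"
      unfolding waring_sum_ok_def by blast
    obtain f g where f: "\<And>y. f y < b" and g: "\<And>y. y ^ K = w ^ f y * \<phi> (g y ^ k)"
      using pow by metis
    obtain ys where ys: "length ys = n" "(\<Sum>i<b. w ^ i * \<phi> x) = (\<Sum>y\<leftarrow>ys. y ^ K)"
      using W unfolding waring_sum_ok_def by blast
    have \<phi>_sum: "(\<Sum>y\<leftarrow>zs. w ^ i * \<phi> (h y)) = w ^ i * \<phi> (\<Sum>y\<leftarrow>zs. h y)" for zs i and h :: "'f \<Rightarrow> 'e"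
      by (induction zs) (simp_all add: additive_zero[of \<phi>, OF add] add distrib_left)
    \<comment> \<open>\<open>zs i\<close> collects the summands whose powers lie on the line of
      \<open>w ^ i\<close>.\<close>
    define zs where "zs = (\<lambda>i. filter (\<lambda>y. f y = i) ys)"
    have "(\<Sum>y\<leftarrow>ys. y ^ K) = (\<Sum>i<b. \<Sum>y\<leftarrow>zs i. y ^ K)"
      unfolding zs_def by (rule sum_list_eq_sum_filter) (rule f)
    also have "\<dots> = (\<Sum>i<b. \<Sum>y\<leftarrow>zs i. w ^ i * \<phi> (g y ^ k))"
      by (intro sum.cong arg_cong[of _ _ sum_list] map_cong) (auto simp: zs_def g)
    also have "\<dots> = (\<Sum>i<b. w ^ i * \<phi> (\<Sum>y\<leftarrow>zs i. g y ^ k))"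
      by (simp only: \<phi>_sum)
    finally have eq: "x = (\<Sum>y\<leftarrow>zs i. g y ^ k)" if "i < b" for i
      using indep[of "\<lambda>_. x" _ i] that ys(2) by simp
    \<comment> \<open>A shorter block could be padded with zeros to exactly \<open>n div b\<close>
      powers with sum \<open>x\<close>. So all \<open>b\<close> blocks are longer than that, which
      together exceeds \<open>n\<close>.\<close>
    have "Suc (n div b) \<le> length (zs i)" if "i < b" for i
    proof (rule ccontr)
      assume "\<not> ?thesis"
      hence "length (map g (zs i) @ replicate (n div b - length (zs i)) 0) = n div b" by simp
      from x[OF this] eq[OF that] show False
        using \<open>k > 0\<close> by (simp add: sum_list_replicate power_0_left comp_def)
    qed
    hence "(\<Sum>i<b. Suc (n div b)) \<le> (\<Sum>i<b. length (zs i))" by (intro sum_mono) simp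
    also have "\<dots> = n"
      using sum_list_eq_sum_filter[of f b "\<lambda>_. 1 :: nat" ys, OF f] ys(1)
      by (simp add: zs_def sum_list_triv)
    finally have "b * Suc (n div b) \<le> n" by simp
    thus False using dividend_less_times_div[OF \<open>b > 0\<close>, of n] by simp
  qed
next
  assume W: "waring_sum_ok TYPE('e) k (n div b)"
  \<comment> \<open>Here \<open>n div b\<close> powers per coordinate suffice; the remaining
    \<open>n mod b\<close> summands are zeros supplied by monotonicity.\<close>
  have "waring_sum_ok TYPE('f) K (b * (n div b))"
    unfolding waring_sum_ok_def
  proof
    fix x
    obtain v where v: "x = (\<Sum>i<b. w ^ i * \<phi> (v i))" using span by blast
    have one: "\<exists>ys. length ys = n div b \<and> w ^ i * \<phi> z = (\<Sum>y\<leftarrow>ys. y ^ K)" if i: "i < b" for i z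
    proof -
      obtain zs where zs: "length zs = n div b" "z = (\<Sum>y\<leftarrow>zs. y ^ k)"
        using W unfolding waring_sum_ok_def by blast
      obtain h where h: "\<And>u. w ^ i * \<phi> (u ^ k) = h u ^ K" using pow'[OF i] by metis
      have "w ^ i * \<phi> (\<Sum>y\<leftarrow>zs. y ^ k) = (\<Sum>y\<leftarrow>map h zs. y ^ K)"
        by (induction zs) (simp_all add: additive_zero[of \<phi>, OF add] add distrib_left h)
      thus ?thesis using zs by (intro exI[of _ "map h zs"]) simp
    qed
    have "\<exists>ys. length ys = m * (n div b) \<and> (\<Sum>i<m. w ^ i * \<phi> (v i)) = (\<Sum>y\<leftarrow>ys. y ^ K)"
      if "m \<le> b" for m
      using that
    proof (induction m)
      case (Suc m)
      then obtain ys where "length ys = m * (n div b)"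
        "(\<Sum>i<m. w ^ i * \<phi> (v i)) = (\<Sum>y\<leftarrow>ys. y ^ K)" by auto
      moreover obtain zs where "length zs = n div b" "w ^ m * \<phi> (v m) = (\<Sum>y\<leftarrow>zs. y ^ K)"
        using one[of m "v m"] Suc.prems by auto
      ultimately show ?case by (intro exI[of _ "ys @ zs"]) simp
    qed simp
    from this[of b] show "\<exists>ys. length ys = b * (n div b) \<and> x = (\<Sum>y\<leftarrow>ys. y ^ K)"
      unfolding v by blast
  qed
  thus "waring_sum_ok TYPE('f) K n"
    by (rule waring_sum_ok_mono) (use \<open>K > 0\<close> in simp_all)
qed

text \<open>Since \<open>l \<le> n div b\<close> means \<open>b * l \<le> n\<close>, the least
  admissible \<open>n\<close> is \<open>b\<close> times the least admissible \<open>l\<close>;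
  nonexistence transfers as well.\<close>

lemma waring_number_scale:
  assumes "b > 0" and "\<And>n. waring_sum_ok T K n \<longleftrightarrow> waring_sum_ok U k (n div b)"
  shows "waring_number T K = map_option (\<lambda>g. b * g) (waring_number U k)"
proof (cases "\<exists>s. waring_sum_ok U k s")
  case True
  define l where "l = (LEAST s. waring_sum_ok U k s)"
  have l: "waring_sum_ok U k l" using True unfolding l_def by (auto intro: LeastI)
  have "(LEAST s. waring_sum_ok T K s) = b * l"
  proof (rule Least_equality)
    show "waring_sum_ok T K (b * l)" using l assms by simp
    fix n assume "waring_sum_ok T K n"
    hence "l \<le> n div b" unfolding l_def assms(2) by (rule Least_le)
    thus "b * l \<le> n" using times_div_less_eq_dividend[of b n] mult_le_mono2 order.trans by blast
  qed
  moreover have "waring_sum_ok T K (b * l)" using l assms by simp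
  ultimately show ?thesis using True by (auto simp: waring_number_def l_def)
qed (auto simp: waring_number_def assms(2))

section \<open>Roots of unity as a basis over the smaller field\<close>

lemma CHAR_finite_field:
  assumes "prime p" and "card (UNIV :: 'a::{field,finite} set) = p ^ n"
  shows "CHAR('a) = p"
proof -
  have "prime CHAR('a)" by (rule prime_CHAR_semidom[OF finite_imp_CHAR_pos]) simp
  moreover have "CHAR('a) dvd p"
    using CHAR_dvd_CARD[where 'a = 'a] \<open>prime CHAR('a)\<close> prime_dvd_power assms(2) by metis
  ultimately show ?thesis using assms(1) primes_dvd_imp_eq by blast
qed

text \<open>Read the coordinates as coefficients of a polynomial of degree below \<open>b\<close>.
  Its value at \<open>w\<close> determines, by Frobenius, its values at the \<open>b\<close>
  distinct conjugates of \<open>w\<close>, hence the polynomial itself. Spanning then follows by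
  counting.\<close>

lemma generator_powers_basis:
  fixes \<phi> :: "'e::{field,finite} \<Rightarrow> 'f::{field,finite}" and w :: 'f and p a b N :: nat
  assumes p: "prime p" and cardE: "card (UNIV :: 'e set) = p ^ a"
    and cardF: "card (UNIV :: 'f set) = (p ^ a) ^ b"
    and inj: "inj \<phi>" and pow: "\<And>x n. \<phi> (x ^ n) = \<phi> x ^ n"
    and ord: "\<And>j. w ^ j = 1 \<longleftrightarrow> N dvd j" and N: "\<And>d. N dvd (p ^ a) ^ d - 1 \<longleftrightarrow> b dvd d"
  shows "\<And>u v i. (\<Sum>i<b. w ^ i * \<phi> (u i)) = (\<Sum>i<b. w ^ i * \<phi> (v i)) \<Longrightarrow> i < b \<Longrightarrow> u i = v i"
    and "\<And>x. \<exists>v. x = (\<Sum>i<b. w ^ i * \<phi> (v i))"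
proof -
  define Q where "Q = p ^ a"
  have "Q > 1" using finite_field_card_gt_1[where 'a = 'e] cardE by (simp add: Q_def)
  have "Q ^ b > 1" using finite_field_card_gt_1[where 'a = 'f] cardF by (simp add: Q_def)
  hence "N > 0" using N[of b] by (auto simp: Q_def intro!: Nat.gr0I)
  have w_iff: "w ^ Q ^ d = w \<longleftrightarrow> b dvd d" for d
  proof -
    have "w ^ (Q ^ d) = w ^ (Q ^ d - 1) * w"
      using \<open>Q > 1\<close> by (simp only: power_minus_mult zero_less_power)
    moreover have "w \<noteq> 0"
      using ord[of N] \<open>N > 0\<close> by (auto simp: power_0_left)
    ultimately show ?thesis using ord[of "Q ^ d - 1"] N[of d] by (simp add: Q_def)
  qed
  have conj_inj: "inj_on (\<lambda>j. w ^ Q ^ j) {..<b}"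
  proof (rule linorder_inj_onI)
    fix i j assume ij: "i < j" "i \<in> {..<b}" "j \<in> {..<b}"
    show "w ^ Q ^ i \<noteq> w ^ Q ^ j"
    proof
      assume "w ^ Q ^ i = w ^ Q ^ j"
      \<comment> \<open>Applying Frobenius \<open>b - i\<close> more times moves the left side to
        \<open>w ^ Q ^ b\<close>, which is \<open>w\<close>.\<close>
      hence "(w ^ Q ^ i) ^ Q ^ (b - i) = (w ^ Q ^ j) ^ Q ^ (b - i)" by simp
      hence "w ^ Q ^ b = w ^ Q ^ (b + (j - i))"
        using ij by (simp add: power_mult[symmetric] power_add[symmetric] add.commute)
      hence "b dvd j - i" using w_iff[of b] w_iff[of "b + (j - i)"] by simp
      from dvd_imp_le[OF this] ij show False by auto
    qed
  qed auto
  define P where "P = (\<lambda>v. \<Sum>i<b. monom (\<phi> (v i)) i)"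
  have coeff_P: "coeff (P v) i = (if i < b then \<phi> (v i) else 0)" for v i
    by (auto simp: P_def coeff_sum sum.delta' if_distrib cong: if_cong)
  have poly_P: "poly (P v) (w ^ Q ^ j) = (\<Sum>i<b. w ^ i * \<phi> (v i)) ^ Q ^ j" for v j
  proof -
    have "(\<Sum>i<b. w ^ i * \<phi> (v i)) ^ Q ^ j = (\<Sum>i<b. (w ^ i * \<phi> (v i)) ^ Q ^ j)"
      by (rule freshmans_dream_sum'[of _ "a * j"])
         (simp_all add: Q_def power_mult p CHAR_finite_field[OF p, of "a * b"] cardF)
    also have "\<dots> = (\<Sum>i<b. \<phi> (v i) * (w ^ Q ^ j) ^ i)"
    proof (intro sum.cong refl)
      fix i
      \<comment> \<open>Frobenius fixes the coefficients, as \<open>'e\<close> has \<open>Q\<close>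
        elements; it moves only \<open>w\<close>.\<close>
      have "x ^ Q ^ j = x" for x :: 'e
      proof (induction j)
        case (Suc j)
        thus ?case using finite_field_power_card[of x] cardE by (simp add: power_mult Q_def)
      qed simp
      hence "\<phi> (v i) ^ Q ^ j = \<phi> (v i)" by (simp flip: pow)
      thus "(w ^ i * \<phi> (v i)) ^ Q ^ j = \<phi> (v i) * (w ^ Q ^ j) ^ i"
        by (simp add: power_mult_distrib mult.commute flip: power_mult)
    qed
    finally show ?thesis by (simp add: P_def poly_sum poly_monom)
  qed
  show indep: "u i = v i" if eq: "(\<Sum>i<b. w ^ i * \<phi> (u i)) = (\<Sum>i<b. w ^ i * \<phi> (v i))" and "i < b" for u v i
  proof -
    have deg: "degree (P v) < b" for v
      using \<open>i < b\<close> by (intro degree_lessI) (auto simp: coeff_P)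
    have "P u = P v"
    proof (rule poly_eqI_degree)
      show "poly (P u) x = poly (P v) x" if "x \<in> (\<lambda>j. w ^ Q ^ j) ` {..<b}" for x
        using that eq by (auto simp: poly_P)
    qed (simp_all add: card_image[OF conj_inj] deg)
    hence "\<phi> (u i) = \<phi> (v i)" using coeff_P[of u i] coeff_P[of v i] \<open>i < b\<close> by simp
    thus ?thesis using inj by (simp add: inj_eq)
  qed
  define \<Psi> where "\<Psi> = (\<lambda>v. \<Sum>i<b. w ^ i * \<phi> (v i))"
  \<comment> \<open>Extensional functions make the set of coordinate vectors finite, of size
    \<open>Q ^ b\<close>, the same as the field.\<close>
  define D where "D = ({..<b} \<rightarrow>\<^sub>E (UNIV :: 'e set))"
  have "inj_on \<Psi> D"
  proof (rule inj_onI)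
    fix u v assume "u \<in> D" "v \<in> D" "\<Psi> u = \<Psi> v"
    thus "u = v" unfolding D_def \<Psi>_def using indep[of u v] by (intro PiE_ext) auto
  qed
  hence "card (\<Psi> ` D) = card (UNIV :: 'f set)"
    by (simp add: card_image D_def card_PiE cardE cardF)
  hence "\<Psi> ` D = UNIV" by (intro card_subset_eq) auto
  thus "\<exists>v. x = (\<Sum>i<b. w ^ i * \<phi> (v i))" for x
    unfolding \<Psi>_def by (metis (no_types, lifting) UNIV_I imageE)
qed

text \<open>The field-theoretic half of the argument: the arithmetic of \<open>b\<close> and
  \<open>c\<close> enters only through \<open>c\<close> and \<open>ord_Q\<close>. Nonzero
  \<open>K\<close>-th powers are the powers of an element \<open>w\<close> of order
  \<open>b * c\<close>, and nonzero \<open>k\<close>-th powers are the \<open>c\<close>-th roots of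
  unity.\<close>

lemma waring_number_extension:
  fixes p a b c :: nat
  assumes p: "prime p" and "b > 0"
    and cardE: "card (UNIV :: 'e::{field,finite} set) = p ^ a"
    and cardF: "card (UNIV :: 'f::{field,finite} set) = (p ^ a) ^ b"
    and c: "c dvd p ^ a - 1"
    and ord_Q: "\<And>d. b * c dvd (p ^ a) ^ d - 1 \<longleftrightarrow> b dvd d"
  shows "waring_number TYPE('f) (((p ^ a) ^ b - 1) div (b * c))
    = map_option (\<lambda>g. b * g) (waring_number TYPE('e) ((p ^ a - 1) div c))"
proof -
  define Q where "Q = p ^ a"
  define K where "K = (Q ^ b - 1) div (b * c)"
  define k where "k = (Q - 1) div c"
  have "Q > 1" "Q ^ b > 1"
    using finite_field_card_gt_1[where 'a = 'e] finite_field_card_gt_1[where 'a = 'f] cardE cardF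
    by (simp_all add: Q_def)
  \<comment> \<open>The case \<open>d = b\<close> of \<open>ord_Q\<close> makes the division
    defining \<open>K\<close> exact.\<close>
  have K: "card (UNIV :: 'f set) - 1 = K * (b * c)"
    using ord_Q[of b] by (simp add: K_def cardF Q_def)
  have k: "card (UNIV :: 'e set) - 1 = k * c"
    using c by (simp add: k_def cardE Q_def)
  have pos: "K > 0" "k > 0" "c > 0"
    using K k \<open>Q > 1\<close> \<open>Q ^ b > 1\<close> by (auto simp: cardE cardF Q_def intro!: Nat.gr0I)
  have "Q - 1 dvd Q ^ b - 1"
    unfolding power_diff_one_eq_geometric_sum[OF less_imp_le[OF \<open>Q > 1\<close>]] by simp
  hence dvd: "card (UNIV :: 'e set) - 1 dvd card (UNIV :: 'f set) - 1"
    unfolding cardE cardF Q_def .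
  have p0: "of_nat p = (0 :: 'e)" "of_nat p = (0 :: 'f)"
    using of_nat_CHAR[where 'a = 'e] of_nat_CHAR[where 'a = 'f] CHAR_finite_field[OF p cardE]
      CHAR_finite_field[OF p, where 'a = 'f and n = "a * b"] cardF by (simp_all add: power_mult)
  obtain \<phi> :: "'e \<Rightarrow> 'f" where add: "\<And>x y. \<phi> (x + y) = \<phi> x + \<phi> y"
    and mult: "\<And>x y. \<phi> (x * y) = \<phi> x * \<phi> y" and one: "\<phi> 1 = 1"
    using finite_field_embedding[OF p p0 dvd] by metis
  have pow: "\<phi> (x ^ n) = \<phi> x ^ n" for x n by (induction n) (simp_all add: one mult)
  have zero: "\<phi> 0 = 0" by (rule additive_zero[of \<phi>, OF add])
  have inj: "inj \<phi>"
  proof (rule injI)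
    fix x y assume "\<phi> x = \<phi> y"
    moreover have "\<phi> x = \<phi> (x - y) + \<phi> y" by (simp flip: add)
    ultimately have "\<phi> (x - y) = 0" by simp
    moreover have "\<phi> z * \<phi> (inverse z) = 1" if "z \<noteq> 0" for z
      using that by (simp flip: mult add: one)
    ultimately show "x = y" by (metis eq_iff_diff_eq_0 mult_zero_left zero_neq_one)
  qed
  obtain w :: 'f where w: "\<And>j. w ^ j = 1 \<longleftrightarrow> b * c dvd j"
    and sub: "\<And>x. x ^ (b * c) = 1 \<longleftrightarrow> (\<exists>j. x = w ^ j)"
    using finite_field_power_subgroup(1)[OF K] by blast
  note sub' = finite_field_power_subgroup(2)[OF K] and subE = finite_field_power_subgroup(2)[OF k]
  \<comment> \<open>Both fields contain exactly \<open>c\<close> of these roots, so those of the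
    larger field all come from the smaller one.\<close>
  have roots: "\<phi> ` {y. y ^ c = 1} = {x. x ^ c = 1}"
  proof (rule card_subset_eq)
    have "card (\<phi> ` {y. y ^ c = 1}) = c"
      using card_image[OF inj_on_subset[OF inj subset_UNIV]] k
      by (simp add: card_roots_of_unity_finite_field)
    also have "c = card {x :: 'f. x ^ c = 1}"
      using K by (simp add: card_roots_of_unity_finite_field)
    finally show "card (\<phi> ` {y. y ^ c = 1}) = card {x :: 'f. x ^ c = 1}" .
  qed (auto simp: one simp flip: pow)
  have pow_dest: "\<exists>i<b. \<exists>u. y ^ K = w ^ i * \<phi> (u ^ k)" for y
  proof (cases "y = 0")
    case True
    thus ?thesis using \<open>b > 0\<close> pos by (intro exI[of _ 0] conjI) (simp_all add: zero power_0_left)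
  next
    case False
    then obtain j where j: "y ^ K = w ^ j" using sub sub' by metis
    \<comment> \<open>The remainder of \<open>j\<close> modulo \<open>b\<close> selects the basis
      element; the rest is a power of \<open>w ^ b\<close>, hence a \<open>c\<close>-th root of
      unity and the image of a \<open>k\<close>-th power.\<close>
    have "w ^ j = w ^ (b * (j div b) + j mod b)" by simp
    also have "\<dots> = w ^ (j mod b) * w ^ (b * (j div b))" by (simp only: power_add mult.commute)
    finally have split: "w ^ j = w ^ (j mod b) * w ^ (b * (j div b))" .
    have "(w ^ (b * (j div b))) ^ c = 1" unfolding power_mult[symmetric] w by simp
    then obtain z where "z ^ c = 1" "w ^ (b * (j div b)) = \<phi> z" using roots by blast
    moreover from this(1) obtain u where "z = u ^ k" using subE by blast
    ultimately have "y ^ K = w ^ (j mod b) * \<phi> (u ^ k)" using j split by simp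
    moreover have "j mod b < b" using \<open>b > 0\<close> by simp
    ultimately show ?thesis by blast
  qed
  have pow_intro: "\<exists>y. w ^ i * \<phi> (u ^ k) = y ^ K" for i u
  proof (cases "u = 0")
    case True
    thus ?thesis using pos by (intro exI[of _ 0]) (simp add: zero power_0_left)
  next
    case False
    hence "(u ^ k) ^ c = 1" using subE by blast
    hence "\<phi> (u ^ k) ^ c = 1" by (simp only: pow[symmetric] one)
    moreover have "(w ^ i) ^ (b * c) = 1" unfolding power_mult[symmetric] w by simp
    ultimately have "(w ^ i * \<phi> (u ^ k)) ^ (b * c) = 1"
      by (simp add: power_mult_distrib mult.commute[of b] power_mult)
    thus ?thesis using sub' by blast
  qed
  note basis = generator_powers_basis[OF p cardE cardF inj pow w ord_Q]
  have "waring_sum_ok TYPE('f) K n \<longleftrightarrow> waring_sum_ok TYPE('e) k (n div b)" for n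
  proof (rule waring_sum_ok_extension_iff[OF \<open>b > 0\<close> pos(1,2) add])
    show "u i = v i" if "(\<Sum>i<b. w ^ i * \<phi> (u i)) = (\<Sum>i<b. w ^ i * \<phi> (v i))" "i < b" for u v i
      by (rule basis(1)[OF that])
  qed (rule basis(2) pow_dest pow_intro)+
  thus ?thesis
    unfolding K_def Q_def k_def by (rule waring_number_scale[OF \<open>b > 0\<close>])
qed

section \<open>Congruences of \<open>p ^ a\<close> modulo the primes dividing \<open>b\<close> and
  modulo 4\<close>

theorem mainTheorem15:
  fixes p a c b t s b' :: nat
    and r tt :: "nat \<Rightarrow> nat"
  assumes "prime p" and "a > 0" and "c > 0"
    and "primitive_divisor p a c"
    and "s \<ge> 1"
    and "inj_on r {..<s}"
    and "\<forall>i<s. prime (r i) \<and> odd (r i) \<and> tt i \<ge> 1"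
    and "b = 2 ^ t * (\<Prod>i<s. r i ^ tt i)"
    and "coprime p b"
    and "b' = (\<Prod>i<s. r i ^ tt i)"
    and "coprime ((p ^ a - 1) div c) b"
    and "\<forall>i<s. \<exists>h. h \<le> tt i - 1 \<and> ord (r i ^ tt i) (p ^ a) = r i ^ h"
    and "t \<in> {0, 1} \<or> (t \<ge> 2 \<and> [p ^ a = 1] (mod 4))"
    and "card (UNIV :: 'F set) = p ^ (2 ^ t * a * b')"
    and "card (UNIV :: 'E set) = p ^ a"
  shows "waring_number TYPE('F::{field,finite}) ((p ^ (2 ^ t * a * b') - 1) div (2 ^ t * b' * c))
         = map_option (\<lambda>g. 2 ^ t * b' * g) (waring_number TYPE('E::{field,finite}) ((p ^ a - 1) div c))"
proof -
  define Q where "Q = p ^ a"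
  have r: "prime (r i)" "odd (r i)" "tt i \<ge> 1" if "i < s" for i
    using assms(7) that by auto
  have b: "b = 2 ^ t * b'" by (simp add: assms(8,10))
  have "b' > 0" unfolding assms(10) using r by (auto simp: prime_gt_0_nat intro!: prod_pos)
  hence "b > 0" by (simp add: b)
  have "odd b'" unfolding assms(10) using r by (simp add: even_prod_iff)
  have card: "p ^ (2 ^ t * a * b') = Q ^ b"
    unfolding Q_def b by (simp add: mult_ac flip: power_mult)
  have "Q > 1" using finite_field_card_gt_1[where 'a = 'E] assms(15) by (simp add: Q_def)
  \<comment> \<open>For \<open>l = 2\<close>, coprimality of \<open>p\<close> and \<open>b\<close>
    makes \<open>Q\<close> odd. An odd \<open>l\<close> is one of the \<open>r i\<close>, where the
    order being a power of \<open>r i\<close> gives the congruence.\<close>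
  have cong_prime: "[Q = 1] (mod l)" if l: "prime l" "l dvd b" for l
  proof (cases "l = 2")
    case True
    hence "odd p" using coprime_common_divisor[OF assms(9), of 2] l(2) by auto
    hence "odd Q" by (simp add: Q_def)
    thus ?thesis using True by (simp add: cong_def odd_iff_mod_2_eq_one)
  next
    case False
    have "\<not> l dvd 2 ^ t"
      using False l(1) prime_dvd_power primes_dvd_imp_eq two_is_prime_nat by blast
    hence "l dvd (\<Prod>i<s. r i ^ tt i)"
      using l prime_dvd_mult_iff unfolding b assms(10) by blast
    then obtain i where i: "i < s" "l dvd r i ^ tt i"
      using l(1) by (auto simp: prime_dvd_prod_iff)
    hence "l = r i"
      using l(1) r prime_dvd_power primes_dvd_imp_eq by blast
    moreover obtain h where "ord (r i ^ tt i) Q = r i ^ h"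
      using assms(12) i(1) unfolding Q_def by blast
    ultimately show ?thesis
      using cong_one_if_ord_prime_power r[OF i(1)] by blast
  qed
  \<comment> \<open>As \<open>b'\<close> is odd, 4 must divide \<open>2 ^ t\<close>, which leaves
    only the case in which the congruence is assumed.\<close>
  have cong_four: "[Q = 1] (mod 4)" if "4 dvd b"
  proof -
    have "coprime 4 b'" using \<open>odd b'\<close> coprime_power_left_iff[of 2 2 b'] by simp
    hence "4 dvd (2 :: nat) ^ t" using that unfolding b by (simp add: coprime_dvd_mult_left_iff)
    hence "t \<notin> {0, 1}" by (auto intro!: Nat.gr0I)
    thus ?thesis using assms(13) by (simp add: Q_def)
  qed
  have c: "c dvd Q - 1" using assms(4) by (simp add: primitive_divisor_def Q_def)
  have "b * c dvd Q ^ d - 1 \<longleftrightarrow> b dvd d" for d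
    using mult_dvd_power_diff_one_iff[OF \<open>b > 0\<close> c \<open>Q > 1\<close> _ cong_prime cong_four] assms(11)
    by (simp add: Q_def)
  from waring_number_extension[OF assms(1) \<open>b > 0\<close> assms(15) _ c[unfolded Q_def] this[unfolded Q_def],
      where 'f = 'F]
  show ?thesis using assms(14) unfolding card b Q_def by simp
qed

end
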